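(* Let $a,b\in\mathbb{R}$, and let $\{P_n(z)\}_{n=0}^{\infty}$ be the sequence of polynomials in $z$ generated by $$\sum_{n=0}^{\infty}P_{n}(z)t^{n}=\frac{1}{\left((az+b)t+1\right)\left(t^{2}+zt+1\right)}.$$ Then all the zeros (in $\mathbb{C}$) of all the polynomials $P_n(z)$, $n\ge 0$, are real if and only if $|b|\le 1-2|a|$. Moreover, if $|b|\le 1-2|a|$, then for every $n$ the zeros of $P_n(z)$ lie on the open interval $(-2,2)$, and they are dense there as $n\to\infty$, i.e. every nonempty open subinterval of $(-2,2)$ contains a zero of $P_n(z)$ for all sufficiently large $n$.
   Context: The right-hand side of the generating function is expanded as a formal power series in $t$ whose coefficients are polynomials in $z$ with real coefficients; $P_n(z)$ is the coefficient of $t^n$. *)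

theory Defs
  imports "HOL-Analysis.Analysis" "HOL-Computational_Algebra.Computational_Algebra"
begin

(* Power series in t (fps_X) over the ring of real polynomials in z; [:b, a:] is a * z + b. *)
definition gen_denom :: "real \<Rightarrow> real \<Rightarrow> real poly fps" where
  "gen_denom a b =
     (fps_const [:b, a:] * fps_X + 1) * (fps_X\<^sup>2 + fps_const [:0, 1:] * fps_X + 1)"

(* "real poly" is not of class inverse, so the reciprocal of the denominator is given by its
   defining equation; ex1_generated below shows that this determines P uniquely. *)
definition generated :: "real \<Rightarrow> real \<Rightarrow> (nat \<Rightarrow> real poly) \<Rightarrow> bool" where
  "generated a b P \<longleftrightarrow> Abs_fps P * gen_denom a b = 1"

lemma ex1_generated: "\<exists>!P. generated a b P"
proof -
  define Q where "Q = fps_right_inverse (gen_denom a b) 1"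
  have "fps_nth (gen_denom a b) 0 = 1"
    by (simp add: gen_denom_def power2_eq_square)
  hence Q: "gen_denom a b * Q = 1"
    unfolding Q_def by (intro fps_right_inverse) simp
  show ?thesis
  proof (rule ex1I[of _ "fps_nth Q"])
    show "generated a b (fps_nth Q)"
      using Q by (simp add: generated_def fps_nth_inverse mult.commute)
  next
    fix P assume "generated a b P"
    hence P: "Abs_fps P * gen_denom a b = 1"
      by (simp add: generated_def)
    have "Abs_fps P = Abs_fps P * (gen_denom a b * Q)"
      by (simp only: Q mult_1_right)
    also have "\<dots> = Abs_fps P * gen_denom a b * Q"
      by (simp only: mult.assoc)
    also have "\<dots> = Q"
      by (simp only: P mult_1_left)
    finally have "fps_nth (Abs_fps P) = fps_nth Q"
      by (rule arg_cong)
    thus "P = fps_nth Q" by (simp add: Abs_fps_inverse)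
  qed
qed

definition complex_zeros :: "real poly \<Rightarrow> complex set" where
  "complex_zeros p = {z. poly (map_poly complex_of_real p) z = 0}"

end

theory Submission
  imports Defs "HOL-Complex_Analysis.Great_Picard"
begin

text \<open>
  Write \<open>z = - (u + 1/u)\<close>, so that \<open>t\<^sup>2 + z t + 1 = (1 - u t) (1 - t/u)\<close>, and put
  \<open>w = - (a z + b)\<close>. The denominator is then \<open>(1 - u t) (1 - t/u) (1 - w t)\<close>, and partial fractions
  give \<open>P\<^sub>n(z)\<close> as a combination of \<open>u\<^sup>n\<close>, \<open>u\<^bsup>-n\<^esup>\<close> and \<open>w\<^sup>n\<close>
  (\<open>generated_closed_form\<close>). Where the zeros are depends on which of these powers dominates.

  If \<open>\<bar>b\<bar> \<le> 1 - 2 \<bar>a\<bar>\<close>, take \<open>u = e\<^bsup>i\<theta>\<^esup>\<close> with \<open>0 < \<theta> < \<pi>\<close>; then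
  \<open>\<bar>w\<bar> \<le> 1\<close> and, up to a positive factor, \<open>P\<^sub>n(-2 cos \<theta>)\<close> equals
  \<open>\<rho> sin ((n+1) \<theta> - \<phi>(\<theta>)) + w\<^bsup>n+2\<^esup> sin \<theta>\<close> where
  \<open>1 - w e\<^bsup>i\<theta>\<^esup> = \<rho> e\<^bsup>-i\<phi>\<^esup>\<close>. Since \<open>\<bar>w sin \<theta>\<bar> < \<rho>\<close>, the oscillating term
  decides the sign whenever the sine is \<open>\<plusminus>1\<close>. The phase \<open>\<phi>\<close> stays strictly between
  \<open>-\<pi>/2\<close> and \<open>\<pi>/2\<close>, so the sine takes the value \<open>(-1)\<^sup>k\<close> at an angle between
  \<open>k\<pi>/(n+1)\<close> and \<open>(k+1)\<pi>/(n+1)\<close>, for each \<open>k \<le> n\<close>. The resulting \<open>n\<close> sign changes give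
  \<open>n\<close> zeros in \<open>(-2,2)\<close>, which are all the zeros because \<open>P\<^sub>n\<close> has degree at most \<open>n\<close>;
  their angles are so evenly spread that they fill the interval as \<open>n\<close> grows.

  If \<open>\<bar>b\<bar> > 1 - 2 \<bar>a\<bar>\<close>, consider nonreal \<open>z\<close>, parametrised by \<open>u = e\<^sup>v\<close> with \<open>v\<close> in the half
  strip \<open>Re v > 0\<close>, \<open>0 < Im v < \<pi>\<close>, so that \<open>\<bar>u\<bar> > 1\<close>. There are points where \<open>w\<close> dominates
  \<open>u\<close> and points where \<open>u\<close> dominates \<open>w\<close>. If no \<open>P\<^sub>n\<close> had a nonreal zero, then
  \<open>P\<^sub>n(z) / u\<^sup>n\<close> would have holomorphic \<open>n\<close>-th roots on the half strip, and by Montel's theorem a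
  subsequence of these roots would converge to a holomorphic function. Its modulus is \<open>1\<close> where \<open>u\<close>
  dominates, hence it is constant, and it is \<open>\<bar>w/u\<bar> > 1\<close> where \<open>w\<close> dominates: a contradiction
  (\<open>growth_rate_rigid\<close>, \<open>nonreal_zero_exists\<close>).
\<close>

section \<open>Evaluating real polynomials at complex points\<close>

definition complex_eval :: "real poly \<Rightarrow> complex \<Rightarrow> complex" where
  "complex_eval p z = poly (map_poly complex_of_real p) z"

lemma complex_eval_simps [simp]:
  "complex_eval 0 z = 0" "complex_eval 1 z = 1" "complex_eval (pCons c p) z = of_real c + z * complex_eval p z"
  by (simp_all add: complex_eval_def map_poly_pCons)

lemma complex_eval_add [simp]: "complex_eval (p + q) z = complex_eval p z + complex_eval q z"
  by (induction p q rule: poly_induct2) (simp_all add: algebra_simps)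

lemma complex_eval_smult [simp]: "complex_eval (smult c p) z = of_real c * complex_eval p z"
  by (induction p) (simp_all add: algebra_simps)

lemma complex_eval_minus [simp]: "complex_eval (- p) z = - complex_eval p z"
  using complex_eval_smult[of "-1" p z] by simp

lemma complex_eval_mult [simp]: "complex_eval (p * q) z = complex_eval p z * complex_eval q z"
  by (induction p) (simp_all add: algebra_simps)

lemma complex_eval_of_real: "complex_eval p (of_real x) = of_real (poly p x)"
  by (induction p) simp_all

lemma continuous_on_complex_eval [continuous_intros]:
  "continuous_on S f \<Longrightarrow> continuous_on S (\<lambda>x. complex_eval p (f x))"
  by (auto simp: complex_eval_def intro!: continuous_intros)

lemma holomorphic_on_complex_eval [holomorphic_intros]:
  "f holomorphic_on S \<Longrightarrow> (\<lambda>x. complex_eval p (f x)) holomorphic_on S"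
  by (induction p) (auto intro!: holomorphic_intros)

section \<open>Recurrence and closed form\<close>

text \<open>
  The coefficients of \<open>t\<close>, \<open>t\<^sup>2\<close> and \<open>t\<^sup>3\<close> in the denominator. Keeping them opaque prevents
  simplification from expanding their products with \<open>P n\<close>.
\<close>

definition denom_coeff1 :: "real \<Rightarrow> real \<Rightarrow> real poly" where "denom_coeff1 a b = [:b, a + 1:]"
definition denom_coeff2 :: "real \<Rightarrow> real \<Rightarrow> real poly" where "denom_coeff2 a b = [:1, b, a:]"
definition denom_coeff3 :: "real \<Rightarrow> real \<Rightarrow> real poly" where "denom_coeff3 a b = [:b, a:]"

lemma gen_denom_expand:
  "gen_denom a b = 1 + fps_const (denom_coeff1 a b) * fps_X + fps_const (denom_coeff2 a b) * fps_X ^ 2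
     + fps_const (denom_coeff3 a b) * fps_X ^ 3"
proof -
  have d: "fps_const (denom_coeff1 a b) = fps_const [:b, a:] + fps_const [:0, 1:]"
    "fps_const (denom_coeff2 a b) = 1 + fps_const [:b, a:] * fps_const [:0, 1:]"
    unfolding denom_coeff1_def denom_coeff2_def fps_const_add fps_const_mult fps_const_1_eq_1 [symmetric]
    by (simp_all add: one_pCons)
  show ?thesis
    unfolding d gen_denom_def denom_coeff3_def
    by (simp add: power2_eq_square power3_eq_cube ring_distribs ac_simps del: fps_const_add fps_const_mult)
qed

lemma generated_recurrence:
  assumes "generated a b P"
  shows "P 0 = 1"
    and "P 1 = - denom_coeff1 a b"
    and "P 2 = - (denom_coeff1 a b * P 1 + denom_coeff2 a b)"
    and "P (n + 3) = - (denom_coeff1 a b * P (n + 2) + denom_coeff2 a b * P (n + 1) + denom_coeff3 a b * P n)"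
proof -
  have g: "Abs_fps P * gen_denom a b = Abs_fps P + fps_const (denom_coeff1 a b) * (fps_X ^ 1 * Abs_fps P)
      + fps_const (denom_coeff2 a b) * (fps_X ^ 2 * Abs_fps P) + fps_const (denom_coeff3 a b) * (fps_X ^ 3 * Abs_fps P)"
    unfolding gen_denom_expand by (simp only: ring_distribs ac_simps power_one_right mult_1_left mult_1_right)
  have e: "P n + denom_coeff1 a b * (if n < 1 then 0 else P (n - 1))
      + denom_coeff2 a b * (if n < 2 then 0 else P (n - 2))
      + denom_coeff3 a b * (if n < 3 then 0 else P (n - 3)) = (if n = 0 then 1 else 0)" for n
    using arg_cong[OF g, of "\<lambda>f. fps_nth f n"] assms
    unfolding generated_def fps_add_nth fps_mult_left_const_nth fps_X_power_mult_nth Abs_fps_inverse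
    by simp
  show p0: "P 0 = 1" using e[of 0] by simp
  show "P 1 = - denom_coeff1 a b" using e[of 1] p0 by (simp add: eq_neg_iff_add_eq_0)
  show "P 2 = - (denom_coeff1 a b * P 1 + denom_coeff2 a b)"
    using e[of 2] p0 by (simp add: eq_neg_iff_add_eq_0 algebra_simps)
  show "P (n + 3) = - (denom_coeff1 a b * P (n + 2) + denom_coeff2 a b * P (n + 1) + denom_coeff3 a b * P n)"
    using e[of "n + 3"] by (simp add: eq_neg_iff_add_eq_0 algebra_simps)
qed

lemma recurrence3_induct [case_names 0 1 2 step]:
  assumes "Q 0" "Q 1" "Q 2"
    "\<And>n. Q n \<Longrightarrow> Q (n + 1) \<Longrightarrow> Q (n + 2) \<Longrightarrow> Q (n + 3)"
  shows "Q (n :: nat)"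
proof -
  have "Q n \<and> Q (n + 1) \<and> Q (n + 2)"
    by (induction n) (use assms in \<open>auto simp: numeral_eq_Suc\<close>)
  thus ?thesis by simp
qed

lemma degree_generated:
  assumes "generated a b P"
  shows "degree (P n) \<le> n"
proof (induction n rule: recurrence3_induct)
  case (step n)
  have c: "degree (denom_coeff1 a b) \<le> 1" "degree (denom_coeff2 a b) \<le> 2" "degree (denom_coeff3 a b) \<le> 1"
    by (auto simp: denom_coeff1_def denom_coeff2_def denom_coeff3_def)
  have "degree (denom_coeff1 a b * P (n + 2)) \<le> n + 3"
    using degree_mult_le[of "denom_coeff1 a b" "P (n + 2)"] c step by linarith
  moreover have "degree (denom_coeff2 a b * P (n + 1)) \<le> n + 3"
    using degree_mult_le[of "denom_coeff2 a b" "P (n + 1)"] c step by linarith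
  moreover have "degree (denom_coeff3 a b * P n) \<le> n + 3"
    using degree_mult_le[of "denom_coeff3 a b" "P n"] c step by linarith
  ultimately show ?case
    unfolding generated_recurrence(4)[OF assms] degree_minus by (intro degree_add_le)
next
  case 2
  have "degree (denom_coeff1 a b * denom_coeff1 a b) \<le> 2"
    using degree_mult_le[of "denom_coeff1 a b" "denom_coeff1 a b"] by (simp add: denom_coeff1_def)
  moreover have "degree (denom_coeff2 a b) \<le> 2" by (simp add: denom_coeff2_def)
  ultimately show ?case
    using generated_recurrence(2,3)[OF assms] by (simp add: degree_diff_le)
qed (use generated_recurrence(1,2)[OF assms] in \<open>auto simp: denom_coeff1_def\<close>)

text \<open>
  The sequence \<open>Q\<close> consists of the complete homogeneous symmetric polynomials in \<open>u\<close>, \<open>v\<close>, \<open>w\<close>, and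
  the right-hand side is the alternant that the bialternant formula divides by the Vandermonde
  determinant. The product form stays valid when two of the roots coincide.
\<close>

lemma vandermonde_recurrence:
  fixes u v w :: "'a :: comm_ring_1"
  assumes "Q 0 = 1" "Q 1 = u + v + w" "Q 2 = (u + v + w) * Q 1 - (u * v + v * w + w * u)"
    and "\<And>n. Q (n + 3) = (u + v + w) * Q (n + 2) - (u * v + v * w + w * u) * Q (n + 1) + u * v * w * Q n"
  shows "(w - u) * (w - v) * (u - v) * Q n =
    w ^ (n + 2) * (u - v) - u ^ (n + 2) * (w - v) + v ^ (n + 2) * (w - u)"
proof (induction n rule: recurrence3_induct)
  case (step n)
  have "(w - u) * (w - v) * (u - v) * Q (n + 3) =
      (u + v + w) * ((w - u) * (w - v) * (u - v) * Q (n + 2))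
    - (u * v + v * w + w * u) * ((w - u) * (w - v) * (u - v) * Q (n + 1))
    + u * v * w * ((w - u) * (w - v) * (u - v) * Q n)"
    unfolding assms(4) by (simp add: algebra_simps)
  also note step(3)
  also note step(2)
  also note step(1)
  also have "(u + v + w) * (w ^ (n + 2 + 2) * (u - v) - u ^ (n + 2 + 2) * (w - v) + v ^ (n + 2 + 2) * (w - u)) -
    (u * v + v * w + w * u) * (w ^ (n + 1 + 2) * (u - v) - u ^ (n + 1 + 2) * (w - v) + v ^ (n + 1 + 2) * (w - u)) +
    u * v * w * (w ^ (n + 2) * (u - v) - u ^ (n + 2) * (w - v) + v ^ (n + 2) * (w - u)) =
    w ^ (n + 3 + 2) * (u - v) - u ^ (n + 3 + 2) * (w - v) + v ^ (n + 3 + 2) * (w - u)"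
    by (simp add: numeral_eq_Suc algebra_simps)
  finally show ?case .
qed (simp_all only: assms; simp add: power2_eq_square power3_eq_cube numeral_eq_Suc algebra_simps)+

text \<open>
  Under \<open>u v = 1\<close> the coefficients of the recurrence are, up to sign, the elementary symmetric
  polynomials in \<open>u\<close>, \<open>v\<close>, \<open>w\<close>.
\<close>

lemma generated_closed_form:
  assumes "generated a b P" and uv: "u * v = 1"
    and z: "z = - (u + v)" and w: "w = - (of_real a * z + of_real b)"
  shows "(w - u) * (w - v) * (u - v) * complex_eval (P n) z =
    w ^ (n + 2) * (u - v) - u ^ (n + 2) * (w - v) + v ^ (n + 2) * (w - u)"
proof (rule vandermonde_recurrence)
  note r = generated_recurrence[OF assms(1)]
  have e1: "complex_eval (denom_coeff1 a b) z = - (u + v + w)"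
    by (simp add: denom_coeff1_def w z algebra_simps)
  have e2: "complex_eval (denom_coeff2 a b) z = u * v + v * w + w * u"
    by (simp add: denom_coeff2_def w z uv[symmetric] algebra_simps)
  have e3: "complex_eval (denom_coeff3 a b) z = - (u * v * w)"
    by (simp add: denom_coeff3_def w uv algebra_simps)
  show "complex_eval (P 0) z = 1" by (simp add: r(1))
  show "complex_eval (P 1) z = u + v + w" unfolding r(2) complex_eval_minus e1 by simp
  show "complex_eval (P 2) z = (u + v + w) * complex_eval (P 1) z - (u * v + v * w + w * u)"
    unfolding r(3) complex_eval_minus complex_eval_add complex_eval_mult e1 e2 by (simp add: algebra_simps)
  show "complex_eval (P (n + 3)) z = (u + v + w) * complex_eval (P (n + 2)) z
    - (u * v + v * w + w * u) * complex_eval (P (n + 1)) z + u * v * w * complex_eval (P n) z" for n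
    unfolding r(4) complex_eval_minus complex_eval_add complex_eval_mult e1 e2 e3
    by (simp add: algebra_simps)
qed

text \<open>
  The base is continuous in \<open>z\<close>, so this bounds the \<open>n\<close>-th roots of \<open>P n\<close> uniformly on compact
  sets, as Montel's theorem requires.
\<close>

lemma generated_exponential_bound:
  assumes "generated a b P"
  shows "cmod (complex_eval (P n) z) \<le>
    (1 + cmod (complex_eval (denom_coeff1 a b) z) + cmod (complex_eval (denom_coeff2 a b) z)
      + cmod (complex_eval (denom_coeff3 a b) z)) ^ n"
proof -
  note r = generated_recurrence[OF assms(1)]
  define c1 c2 c3 where "c1 = cmod (complex_eval (denom_coeff1 a b) z)" and 
     "c2 = cmod (complex_eval (denom_coeff2 a b) z)" and "c3 = cmod (complex_eval (denom_coeff3 a b) z)"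
  define B where "B = 1 + c1 + c2 + c3"
  have c: "0 \<le> c1" "0 \<le> c2" "0 \<le> c3" by (auto simp: c1_def c2_def c3_def)
  have B1: "1 \<le> B" using c by (simp add: B_def)
  have "cmod (complex_eval (P n) z) \<le> B ^ n"
  proof (induction n rule: recurrence3_induct)
    case 0
    show ?case by (simp add: r(1))
  next
    case 1
    show ?case unfolding r(2) complex_eval_minus norm_minus_cancel c1_def[symmetric] using c by (simp add: B_def)
  next
    case 2
    have p1: "cmod (complex_eval (P 1) z) = c1" by (simp only: r(2) c1_def complex_eval_minus norm_minus_cancel)
    have "cmod (complex_eval (P 2) z) \<le> c1 * c1 + c2"
      unfolding r(3) complex_eval_minus norm_minus_cancel complex_eval_add complex_eval_mult 
      using norm_triangle_ineq norm_mult p1 c1_def c2_def by metis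
    also have "\<dots> \<le> B * c1 + B * c2"
      using c by (intro add_mono mult_right_mono) (auto simp: B_def intro: mult_right_mono[of 1 B c2, simplified])
    also have "\<dots> \<le> B * B" unfolding distrib_left[symmetric] using c by (intro mult_left_mono) (auto simp: B_def)
    finally show ?case by (simp add: power2_eq_square)
  next
    case (step n)
    have "cmod (complex_eval (P (n + 3)) z) \<le> c1 * cmod (complex_eval (P (n + 2)) z) + c2 * cmod (complex_eval (P (n + 1)) z)
        + c3 * cmod (complex_eval (P n) z)"
      unfolding r(4) complex_eval_minus norm_minus_cancel complex_eval_add complex_eval_mult
        c1_def c2_def c3_def norm_mult[symmetric]
      by (intro norm_triangle_le add_mono order_refl)
    also have "\<dots> \<le> c1 * B ^ (n + 2) + c2 * B ^ (n + 2) + c3 * B ^ (n + 2)"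
    proof (intro add_mono mult_left_mono)
      show "cmod (complex_eval (P (n + 1)) z) \<le> B ^ (n + 2)"
        by (rule order_trans[OF step(2) power_increasing[OF _ B1]]) simp
      show "cmod (complex_eval (P n) z) \<le> B ^ (n + 2)"
        by (rule order_trans[OF step(1) power_increasing[OF _ B1]]) simp
    qed (use step c in auto)
    also have "\<dots> = (c1 + c2 + c3) * B ^ (n + 2)" by (simp add: algebra_simps)
    also have "\<dots> \<le> B * B ^ (n + 2)" using c by (intro mult_right_mono) (auto simp: B_def)
    finally show ?case by (simp add: power_add numeral_eq_Suc)
  qed
  thus ?thesis by (simp only: B_def c1_def c2_def c3_def)
qed

section \<open>Real zeros by counting sign changes\<close>

text \<open>
  The value of \<open>w = - (a z + b)\<close> at \<open>z = -2 cos \<theta>\<close>.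
\<close>

definition char_root :: "real \<Rightarrow> real \<Rightarrow> real \<Rightarrow> real" where
  "char_root a b \<theta> = 2 * a * cos \<theta> - b"

text \<open>
  The argument of \<open>1 - w e\<^bsup>-i\<theta>\<^esup>\<close>, which has positive real part for the parameters
  considered below.
\<close>

definition phase :: "real \<Rightarrow> real \<Rightarrow> real \<Rightarrow> real" where
  "phase a b \<theta> = arctan (char_root a b \<theta> * sin \<theta> / (1 - char_root a b \<theta> * cos \<theta>))"

text \<open>
  The closed form at \<open>u = e\<^bsup>i\<theta>\<^esup>\<close>, divided by \<open>2 i\<close>: the bracket is
  \<open>\<bar>1 - w e\<^bsup>i\<theta>\<^esup>\<bar>\<^sup>2 = (w - u) (w - v)\<close>.
\<close>

lemma trigonometric_form:
  assumes "generated a b P"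
  defines "w \<equiv> char_root a b"
  shows "((1 - w \<theta> * cos \<theta>)\<^sup>2 + (w \<theta> * sin \<theta>)\<^sup>2) * sin \<theta> * poly (P n) (- 2 * cos \<theta>) =
    w \<theta> ^ (n + 2) * sin \<theta> + (1 - w \<theta> * cos \<theta>) * sin ((real n + 1) * \<theta>) - w \<theta> * sin \<theta> * cos ((real n + 1) * \<theta>)"
proof -
  define u v W m where "u = cis \<theta>" and "v = cis (- \<theta>)" and "W = w \<theta>" and "m = (real n + 1) * \<theta>"
  have uv: "u * v = 1" by (simp add: u_def v_def cis_mult)
  have s: "of_real (- 2 * cos \<theta>) = - (u + v)"
    by (simp add: u_def v_def complex_eq_iff)
  have w: "of_real W = - (of_real a * of_real (- 2 * cos \<theta>) + complex_of_real b)"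
    by (simp add: W_def w_def char_root_def)
  have u: "u ^ (n + 2) = cis m * u" and v: "v ^ (n + 2) = cis (- m) * v"
    unfolding u_def v_def m_def Complex.DeMoivre cis_mult by (rule arg_cong[where f = cis], simp add: algebra_simps)+
  have "u ^ (n + 2) * (of_real W - v) = cis m * (of_real W * u - u * v)" 
    "v ^ (n + 2) * (of_real W - u) = cis (- m) * (of_real W * v - u * v)"
    unfolding u v by (simp_all add: algebra_simps)
  hence p: "u ^ (n + 2) * (of_real W - v) = cis m * (of_real W * u - 1)"
    "v ^ (n + 2) * (of_real W - u) = cis (- m) * (of_real W * v - 1)" by (simp_all only: uv)
  have E: "(of_real W - u) * (of_real W - v) * (u - v) * of_real (poly (P n) (- 2 * cos \<theta>)) =
    of_real W ^ (n + 2) * (u - v) - cis m * (of_real W * u - 1) + cis (- m) * (of_real W * v - 1)"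
    using generated_closed_form[OF assms(1) uv s w, of n] unfolding complex_eval_of_real p .
  have L: "(of_real W - u) * (of_real W - v) * (u - v) = \<i> * of_real (2 * ((1 - W * cos \<theta>)\<^sup>2 + (W * sin \<theta>)\<^sup>2) * sin \<theta>)"
  proof -
    have sum: "u + v = of_real (2 * cos \<theta>)" and diff: "u - v = \<i> * of_real (2 * sin \<theta>)"
      by (simp_all add: u_def v_def complex_eq_iff)
    have "(of_real W - u) * (of_real W - v) = of_real W ^ 2 - of_real W * (u + v) + u * v"
      by (simp add: algebra_simps power2_eq_square)
    also have "\<dots> = of_real (W\<^sup>2 - W * (2 * cos \<theta>) + 1)" unfolding sum uv by simp
    also have "W\<^sup>2 - W * (2 * cos \<theta>) + 1 = (1 - W * cos \<theta>)\<^sup>2 + (W * sin \<theta>)\<^sup>2"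
      unfolding power_mult_distrib[of W "sin \<theta>"] sin_squared_eq by (simp add: power2_eq_square algebra_simps)
    finally show ?thesis unfolding diff by simp
  qed
  have R1: "of_real W ^ (n + 2) * (u - v) = \<i> * of_real (2 * W ^ (n + 2) * sin \<theta>)"
    by (simp add: u_def v_def complex_eq_iff flip: of_real_power)
  have R2: "cis (- m) * (of_real W * v - 1) - cis m * (of_real W * u - 1) = \<i> * of_real (2 * ((1 - W * cos \<theta>) * sin m - W * sin \<theta> * cos m))"
    by (simp add: u_def v_def complex_eq_iff algebra_simps)
  have "\<i> * of_real (2 * ((1 - W * cos \<theta>)\<^sup>2 + (W * sin \<theta>)\<^sup>2) * sin \<theta>) * of_real (poly (P n) (- 2 * cos \<theta>))
    = \<i> * of_real (2 * W ^ (n + 2) * sin \<theta>) + \<i> * of_real (2 * ((1 - W * cos \<theta>) * sin m - W * sin \<theta> * cos m))"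
    using E unfolding L R1[symmetric] R2[symmetric] by (simp only: add_diff_eq diff_add_eq)
  from arg_cong[OF this, of Im] show ?thesis
    unfolding W_def m_def by (simp add: algebra_simps)
qed

lemma arctan_amplitude:
  fixes x y :: real
  assumes "x > 0"
  shows "x * cos (arctan (y / x)) + y * sin (arctan (y / x)) = sqrt (x\<^sup>2 + y\<^sup>2)"
proof -
  have q: "sqrt (1 + (y / x)\<^sup>2) = sqrt (x\<^sup>2 + y\<^sup>2) / x"
  proof -
    have "1 + (y / x)\<^sup>2 = (x\<^sup>2 + y\<^sup>2) / x\<^sup>2" using assms by (simp add: field_simps)
    thus ?thesis using assms by (simp add: real_sqrt_divide)
  qed
  have p: "sqrt (x\<^sup>2 + y\<^sup>2) > 0" using assms by (simp add: add_pos_nonneg)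
  have "x * cos (arctan (y / x)) + y * sin (arctan (y / x)) = (x\<^sup>2 + y\<^sup>2) / sqrt (x\<^sup>2 + y\<^sup>2)"
    unfolding cos_arctan sin_arctan q using assms p by (simp add: field_simps power2_eq_square)
  also have "\<dots> = sqrt (x\<^sup>2 + y\<^sup>2)" by (simp add: real_div_sqrt)
  finally show ?thesis .
qed

lemma abs_char_root_le_1:
  assumes "\<bar>b\<bar> \<le> 1 - 2 * \<bar>a\<bar>"
  shows "\<bar>char_root a b \<theta>\<bar> \<le> 1"
proof -
  have "\<bar>2 * a * cos \<theta>\<bar> \<le> 2 * \<bar>a\<bar>"
    using mult_left_mono[of "\<bar>cos \<theta>\<bar>" 1 "2 * \<bar>a\<bar>"] by (simp add: abs_mult)
  thus ?thesis using assms unfolding char_root_def by linarith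
qed

lemma char_root_cos_less_1:
  assumes "\<bar>b\<bar> \<le> 1 - 2 * \<bar>a\<bar>" "0 < \<theta>" "\<theta> < pi"
  shows "char_root a b \<theta> * cos \<theta> < 1"
proof -
  have "\<bar>cos \<theta>\<bar> < 1"
    using assms cos_monotone_0_pi[of 0 \<theta>] cos_monotone_0_pi[of \<theta> pi] by auto
  hence "\<bar>char_root a b \<theta>\<bar> * \<bar>cos \<theta>\<bar> < 1"
    using abs_char_root_le_1[OF assms(1), of \<theta>] mult_right_mono[of "\<bar>char_root a b \<theta>\<bar>" 1 "\<bar>cos \<theta>\<bar>"] by linarith
  thus ?thesis unfolding abs_mult[symmetric] by linarith
qed

text \<open>
  The bounds \<open>\<plusminus>\<pi>/2\<close> suffice away from the endpoints. At \<open>\<theta> = 0\<close> or \<open>\<theta> = \<pi>\<close> the phase may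
  tend to \<open>\<plusminus>\<pi>/2\<close>, namely when \<open>\<bar>w\<bar>\<close> reaches 1 there; the last two bounds show that it can do so
  only in the direction that enlarges the range of \<open>(n+1) \<theta> - phase a b \<theta>\<close>.
\<close>

lemma phase_bounds:
  assumes "\<bar>b\<bar> \<le> 1 - 2 * \<bar>a\<bar>" "0 < \<theta>" "\<theta> < pi"
  shows "- pi / 2 < phase a b \<theta>" "phase a b \<theta> < pi / 2"
    and "cos \<theta> \<ge> 0 \<Longrightarrow> - pi / 4 \<le> phase a b \<theta>"
    and "cos \<theta> \<le> 0 \<Longrightarrow> phase a b \<theta> \<le> pi / 4"
proof -
  let ?w = "char_root a b \<theta>"
  note d = char_root_cos_less_1[OF assms]
  have s: "0 < sin \<theta>" "sin \<theta> \<le> 1" using assms by (auto intro: sin_gt_zero)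
  have w: "\<bar>?w\<bar> \<le> 1" by (rule abs_char_root_le_1[OF assms(1)])
  have ws: "\<bar>?w * sin \<theta>\<bar> \<le> 1" using w s by (simp add: abs_mult mult_le_one)
  show "- pi / 2 < phase a b \<theta>" "phase a b \<theta> < pi / 2"
    using arctan_bounded by (auto simp: phase_def)
  show "- pi / 4 \<le> phase a b \<theta>" if "cos \<theta> \<ge> 0"
  proof -
    have "- (1 - ?w * cos \<theta>) \<le> ?w * sin \<theta>"
    proof (cases "?w \<ge> 0")
      case True
      hence "0 \<le> ?w * sin \<theta>" using s by simp
      thus ?thesis using d by linarith
    next
      case False
      hence "?w * cos \<theta> \<le> 0" using that by (intro mult_nonpos_nonneg) auto
      thus ?thesis using ws by linarith
    qed
    hence "arctan (- 1) \<le> phase a b \<theta>" unfolding phase_def arctan_le_iff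
      using d by (simp add: pos_le_divide_eq)
    thus ?thesis by (simp add: arctan_minus arctan_one)
  qed
  show "phase a b \<theta> \<le> pi / 4" if "cos \<theta> \<le> 0"
  proof -
    have "?w * sin \<theta> \<le> 1 - ?w * cos \<theta>"
    proof (cases "?w \<le> 0")
      case True
      hence "?w * sin \<theta> \<le> 0" using s by (intro mult_nonpos_nonneg) auto
      thus ?thesis using d by linarith
    next
      case False
      hence "?w * cos \<theta> \<le> 0" using that by (intro mult_nonneg_nonpos) auto
      thus ?thesis using ws by linarith
    qed
    hence "phase a b \<theta> \<le> arctan 1" unfolding phase_def arctan_le_iff
      using d by (simp add: pos_divide_le_eq)
    thus ?thesis by (simp add: arctan_one)
  qed
qed

text \<open>
  At \<open>\<theta> = j \<pi> / (n+1)\<close> the function \<open>\<Psi> \<theta> = (n+1) \<theta> - phase a b \<theta>\<close> differs from \<open>j \<pi>\<close> by less than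
  \<open>\<pi>/2\<close>, so it crosses \<open>k \<pi> + \<pi>/2\<close> between the angles for \<open>j = k\<close> and \<open>j = k + 1\<close>. If one of
  these is \<open>0\<close> or \<open>\<pi>\<close>, where the phase is not controlled by \<open>phase_bounds\<close>, it is moved inwards by a small \<open>\<epsilon>\<close>.
\<close>

lemma extremal_angle_exists:
  fixes n k :: nat
  assumes ab: "\<bar>b\<bar> \<le> 1 - 2 * \<bar>a\<bar>" and k: "k \<le> n"
  shows "\<exists>\<theta>::real. real k * pi / (real n + 1) < \<theta> \<and> \<theta> < (real k + 1) * pi / (real n + 1) \<and>
    (real n + 1) * \<theta> - phase a b \<theta> = real k * pi + pi / 2"
proof -
  define N where "N = real n + 1"
  have N: "N \<ge> 1" "N > 0" by (simp_all add: N_def)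
  have kN: "real k + 1 \<le> N" using k by (simp add: N_def)
  define \<Psi> where "\<Psi> \<theta> = N * \<theta> - phase a b \<theta>" for \<theta>
  define \<epsilon> where "\<epsilon> = pi / (8 * N)"
  have \<epsilon>: "0 < \<epsilon>" "\<epsilon> \<le> pi / 8" "N * \<epsilon> = pi / 8"
    using N by (auto simp: \<epsilon>_def field_simps)
  have top: "(real k + 1) * pi / N \<le> pi"
    using N mult_right_mono[OF kN, of pi] by (simp add: pos_divide_le_eq mult.commute)
  have len: "(real k + 1) * pi / N = real k * pi / N + 8 * \<epsilon>" using N by (simp add: \<epsilon>_def field_simps)
  have bot: "0 \<le> real k * pi / N" using N by simp
  have "\<exists>l. 0 < l \<and> l < pi \<and> real k * pi / N \<le> l \<and> l \<le> real k * pi / N + \<epsilon> \<and> \<Psi> l < real k * pi + pi / 2"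
  proof (cases "k = 0")
    case False
    hence l: "0 < real k * pi / N" "real k * pi / N < pi" using N len \<epsilon> top by auto
    have "\<Psi> (real k * pi / N) < real k * pi + pi / 2"
      using phase_bounds(1)[OF ab l] N by (simp add: \<Psi>_def)
    thus ?thesis using l \<epsilon> by (intro exI[of _ "real k * pi / N"]) auto
  next
    case True
    have l: "0 < \<epsilon>" "\<epsilon> < pi" using \<epsilon> pi_gt_zero by linarith+
    have "cos \<epsilon> \<ge> 0" using \<epsilon> pi_gt_zero by (intro cos_ge_zero) linarith+
    hence "\<Psi> \<epsilon> < real k * pi + pi / 2"
      using phase_bounds(3)[OF ab l] \<epsilon> pi_gt_zero True unfolding \<Psi>_def by simp
    thus ?thesis using l \<epsilon> True by (intro exI[of _ \<epsilon>]) auto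
  qed
  then obtain l where l: "0 < l" "l < pi" "real k * pi / N \<le> l" "l \<le> real k * pi / N + \<epsilon>" "\<Psi> l < real k * pi + pi / 2" by blast
  have "\<exists>r. 0 < r \<and> r < pi \<and> r \<le> (real k + 1) * pi / N \<and> (real k + 1) * pi / N - \<epsilon> \<le> r \<and> real k * pi + pi / 2 < \<Psi> r"
  proof (cases "k = n")
    case False
    hence "real k + 2 \<le> N" using k by (simp add: N_def)
    hence r: "0 < (real k + 1) * pi / N" "(real k + 1) * pi / N < pi"
    proof -
      show "0 < (real k + 1) * pi / N" using N by simp
      have "(real k + 1) * pi < N * pi" using \<open>real k + 2 \<le> N\<close> by (intro mult_strict_right_mono) auto
      thus "(real k + 1) * pi / N < pi" using N by (simp add: pos_divide_less_eq mult.commute)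
    qed
    have "real k * pi + pi / 2 < \<Psi> ((real k + 1) * pi / N)"
    proof -
      have "N * ((real k + 1) * pi / N) = real k * pi + pi"
        using N by (simp add: ring_distribs(2))
      thus ?thesis using phase_bounds(2)[OF ab r] unfolding \<Psi>_def by linarith
    qed
    thus ?thesis using r \<epsilon> by (intro exI[of _ "(real k + 1) * pi / N"]) auto
  next
    case True
    hence e: "(real k + 1) * pi / N = pi" using N by (simp add: N_def)
    have r: "0 < pi - \<epsilon>" "pi - \<epsilon> < pi" using \<epsilon> pi_gt_zero by linarith+
    have "cos \<epsilon> \<ge> 0" using \<epsilon> pi_gt_zero by (intro cos_ge_zero) linarith+
    hence "phase a b (pi - \<epsilon>) \<le> pi / 4" using phase_bounds(4)[OF ab r] by simp
    moreover have "N * (pi - \<epsilon>) = real k * pi + pi - pi / 8" using \<epsilon> True by (simp add: N_def algebra_simps)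
    ultimately have "real k * pi + pi / 2 < \<Psi> (pi - \<epsilon>)"
      unfolding \<Psi>_def using pi_gt_zero by linarith
    thus ?thesis using r \<epsilon> e by (intro exI[of _ "pi - \<epsilon>"]) (auto simp: algebra_simps)
  qed
  then obtain r where r: "0 < r" "r < pi" "r \<le> (real k + 1) * pi / N" "(real k + 1) * pi / N - \<epsilon> \<le> r" "real k * pi + pi / 2 < \<Psi> r"
    by blast
  have "l \<le> r" using l(4) r(4) len \<epsilon> by (simp add: algebra_simps)
  have cont: "continuous_on {l..r} \<Psi>"
    unfolding \<Psi>_def phase_def char_root_def
  proof (intro continuous_intros ballI)
    fix x assume "x \<in> {l..r}"
    thus "1 - (2 * a * cos x - b) * cos x \<noteq> 0"
      using char_root_cos_less_1[OF ab, of x] l r by (auto simp: char_root_def)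
  qed
  obtain \<theta> where \<theta>: "l \<le> \<theta>" "\<theta> \<le> r" "\<Psi> \<theta> = real k * pi + pi / 2"
    using IVT'[OF less_imp_le[OF l(5)] less_imp_le[OF r(5)] \<open>l \<le> r\<close> cont] by blast
  have "\<theta> \<noteq> l" "\<theta> \<noteq> r" using \<theta>(3) l(5) r(5) by auto
  hence "real k * pi / N < \<theta>" "\<theta> < (real k + 1) * pi / N" using \<theta> l r by auto
  thus ?thesis using \<theta>(3) by (intro exI[of _ \<theta>]) (auto simp: \<Psi>_def N_def)
qed

text \<open>
  Here the oscillating term has its full amplitude \<open>sqrt (x\<^sup>2 + y\<^sup>2)\<close>. As \<open>\<bar>w\<bar> \<le> 1\<close>, the
  remaining term is at most \<open>\<bar>w sin \<theta>\<bar> = \<bar>y\<bar>\<close> in modulus, which is smaller because \<open>x > 0\<close>.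
\<close>

lemma sign_at_extremal_angle:
  assumes gen: "generated a b P" and ab: "\<bar>b\<bar> \<le> 1 - 2 * \<bar>a\<bar>" and \<theta>: "0 < \<theta>" "\<theta> < pi"
    and ext: "(real n + 1) * \<theta> - phase a b \<theta> = real k * pi + pi / 2"
  shows "0 < (- 1) ^ k * poly (P n) (- 2 * cos \<theta>)"
proof -
  define w x y where "w = char_root a b \<theta>" and "x = 1 - w * cos \<theta>" and "y = w * sin \<theta>"
  have x: "x > 0" using char_root_cos_less_1[OF ab \<theta>] by (simp add: x_def w_def)
  have s: "sin \<theta> > 0" using \<theta> by (rule sin_gt_zero)
  have w: "\<bar>w\<bar> \<le> 1" unfolding w_def by (rule abs_char_root_le_1[OF ab])
  have ph: "phase a b \<theta> = arctan (y / x)" by (simp add: phase_def x_def y_def w_def)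
  have m: "(real n + 1) * \<theta> = (arctan (y / x) + pi / 2) + real k * pi" using ext ph by simp
  have sc: "sin ((real n + 1) * \<theta>) = (- 1) ^ k * cos (arctan (y / x))" 
    "cos ((real n + 1) * \<theta>) = - ((- 1) ^ k * sin (arctan (y / x)))"
    unfolding m sin_add[of _ "real k * pi"] cos_add[of _ "real k * pi"] by (simp_all add: sin_add cos_add)
  have "(x\<^sup>2 + y\<^sup>2) * sin \<theta> * poly (P n) (- 2 * cos \<theta>)
      = w ^ (n + 2) * sin \<theta> + x * sin ((real n + 1) * \<theta>) - y * cos ((real n + 1) * \<theta>)"
    using trigonometric_form[OF gen, of \<theta> n] by (simp add: x_def y_def w_def add.commute)
  also have "\<dots> = w ^ (n + 2) * sin \<theta> + (- 1) ^ k * sqrt (x\<^sup>2 + y\<^sup>2)"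
    unfolding sc arctan_amplitude[OF x, symmetric] by (simp add: algebra_simps)
  finally have eq: "(x\<^sup>2 + y\<^sup>2) * sin \<theta> * poly (P n) (- 2 * cos \<theta>) = w ^ (n + 2) * sin \<theta> + (- 1) ^ k * sqrt (x\<^sup>2 + y\<^sup>2)" .
  \<comment> \<open>One factor \<open>w\<close> is kept, since \<open>\<bar>w sin \<theta>\<bar> < sqrt (x\<^sup>2 + y\<^sup>2)\<close> is strict while \<open>sin \<theta>\<close> itself equals this root if \<open>w = cos \<theta>\<close>.\<close>
  have "\<bar>w\<bar> ^ (n + 2) \<le> \<bar>w\<bar> ^ 1" using w by (intro power_decreasing) auto
  hence "\<bar>w ^ (n + 2) * sin \<theta>\<bar> \<le> \<bar>y\<bar>" using s by (simp add: abs_mult power_abs y_def mult_right_mono)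
  also have "\<bar>y\<bar> < sqrt (x\<^sup>2 + y\<^sup>2)" using x by (intro real_less_rsqrt) simp
  finally have lt: "\<bar>w ^ (n + 2) * sin \<theta>\<bar> < sqrt (x\<^sup>2 + y\<^sup>2)" .
  have "(x\<^sup>2 + y\<^sup>2) * sin \<theta> * ((- 1) ^ k * poly (P n) (- 2 * cos \<theta>)) =
      (- 1) ^ k * (w ^ (n + 2) * sin \<theta> + (- 1) ^ k * sqrt (x\<^sup>2 + y\<^sup>2))"
    unfolding eq[symmetric] by (simp only: ac_simps)
  also have "\<dots> > 0" using lt by (cases "even k") auto
  finally have "0 < (x\<^sup>2 + y\<^sup>2) * sin \<theta> * ((- 1) ^ k * poly (P n) (- 2 * cos \<theta>))" .
  moreover have "0 < (x\<^sup>2 + y\<^sup>2) * sin \<theta>" using s x by (simp add: add_pos_nonneg)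
  ultimately show ?thesis by (rule zero_less_mult_pos)
qed

text \<open>
  The angles \<open>\<theta>\<close> are the extremal ones, where \<open>P n\<close> alternates in sign; their location is kept for the
  density statement, and their order makes the zeros \<open>\<zeta>\<close> distinct.
\<close>

lemma interlacing_zeros:
  assumes gen: "generated a b P" and ab: "\<bar>b\<bar> \<le> 1 - 2 * \<bar>a\<bar>"
  obtains \<theta> \<zeta> :: "nat \<Rightarrow> real"
  where "\<And>k. k \<le> n \<Longrightarrow> real k * pi / (real n + 1) < \<theta> k \<and> \<theta> k < (real k + 1) * pi / (real n + 1)"
    and "\<And>k. k < n \<Longrightarrow> \<theta> k < \<zeta> k \<and> \<zeta> k < \<theta> (k + 1) \<and> poly (P n) (- 2 * cos (\<zeta> k)) = 0"
    and "P n \<noteq> 0"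
proof -
  have "\<forall>k\<in>{..n}. \<exists>\<theta>::real. real k * pi / (real n + 1) < \<theta> \<and> \<theta> < (real k + 1) * pi / (real n + 1) \<and>
      (real n + 1) * \<theta> - phase a b \<theta> = real k * pi + pi / 2"
    using extremal_angle_exists[OF ab] by blast
  then obtain \<theta> where \<theta>: "\<And>k. k \<le> n \<Longrightarrow> real k * pi / (real n + 1) < \<theta> k \<and> \<theta> k < (real k + 1) * pi / (real n + 1) \<and>
      (real n + 1) * \<theta> k - phase a b (\<theta> k) = real k * pi + pi / 2"
    unfolding bchoice_iff by auto
  have r: "0 < \<theta> k" "\<theta> k < pi" if "k \<le> n" for k
  proof -
    have "0 \<le> real k * pi / (real n + 1)" "(real k + 1) * pi / (real n + 1) \<le> pi" using that by (auto simp: pos_divide_le_eq mult.commute[of pi])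
    thus "0 < \<theta> k" "\<theta> k < pi" using \<theta>[OF that] by linarith+
  qed
  have sg: "0 < (- 1) ^ k * poly (P n) (- 2 * cos (\<theta> k))" if "k \<le> n" for k
    using sign_at_extremal_angle[OF gen ab r[OF that], of n k] \<theta>[OF that] by (simp add: add.commute)
  have ex: "\<exists>\<zeta>. \<theta> k < \<zeta> \<and> \<zeta> < \<theta> (k + 1) \<and> poly (P n) (- 2 * cos \<zeta>) = 0" if k: "k < n" for k
  proof -
    let ?f = "\<lambda>x. (- 1) ^ k * poly (P n) (- 2 * cos x)"
    have 1: "?f (\<theta> (k + 1)) < 0" "0 < ?f (\<theta> k)" using sg[of k] sg[of "k + 1"] k by auto
    have "\<theta> k < \<theta> (k + 1)" using \<theta>[of k] \<theta>[of "k + 1"] k by (auto simp: add.commute)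
    moreover have "continuous_on {\<theta> k..\<theta> (k + 1)} ?f" by (intro continuous_intros)
    ultimately obtain x where x: "\<theta> k \<le> x" "x \<le> \<theta> (k + 1)" "?f x = 0"
      using IVT2'[of ?f "\<theta> (k + 1)" 0 "\<theta> k"] 1 by auto
    moreover have "x \<noteq> \<theta> k" "x \<noteq> \<theta> (k + 1)" using x(3) 1 by (metis less_irrefl)+
    ultimately show ?thesis by (intro exI[of _ x]) auto
  qed
  obtain \<zeta> where "\<And>k. k < n \<Longrightarrow> \<theta> k < \<zeta> k \<and> \<zeta> k < \<theta> (k + 1) \<and> poly (P n) (- 2 * cos (\<zeta> k)) = 0"
    using ex by metis
  moreover have "P n \<noteq> 0" using sg[of 0] by auto
  ultimately show ?thesis using that \<theta> by blast
qed

lemma zeros_in_interval: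
  assumes gen: "generated a b P" and ab: "\<bar>b\<bar> \<le> 1 - 2 * \<bar>a\<bar>"
  shows "complex_zeros (P n) \<subseteq> complex_of_real ` {-2<..<2}"
proof -
  obtain \<theta> \<zeta> :: "nat \<Rightarrow> real"
    where \<theta>: "\<And>k. k \<le> n \<Longrightarrow> real k * pi / (real n + 1) < \<theta> k \<and> \<theta> k < (real k + 1) * pi / (real n + 1)"
      and \<zeta>: "\<And>k. k < n \<Longrightarrow> \<theta> k < \<zeta> k \<and> \<zeta> k < \<theta> (k + 1) \<and> poly (P n) (- 2 * cos (\<zeta> k)) = 0"
      and nz: "P n \<noteq> 0"
    using interlacing_zeros[OF gen ab] by metis
  define X where "X = (\<lambda>k. complex_of_real (- 2 * cos (\<zeta> k))) ` {..<n}"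
  have r: "0 < \<zeta> k" "\<zeta> k < pi" if "k < n" for k
  proof -
    have "0 \<le> real k * pi / (real n + 1)" "(real k + 2) * pi / (real n + 1) \<le> pi" using that by (auto simp: pos_divide_le_eq mult.commute[of pi])
    moreover have "real k * pi / (real n + 1) < \<theta> k" using \<theta>[of k] that by auto
    moreover have "\<theta> (k + 1) < (real k + 2) * pi / (real n + 1)"
      using \<theta>[of "k + 1"] that by (auto simp: add.commute)
    ultimately show "0 < \<zeta> k" "\<zeta> k < pi" using \<zeta>[OF that] by linarith+
  qed
  have less: "\<zeta> i < \<zeta> j" if "i < j" "j < n" for i j
    using that
  proof (induction j)
    case (Suc j)
    have "\<zeta> j < \<zeta> (Suc j)" using \<zeta>[of j] \<zeta>[of "Suc j"] Suc.prems by auto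
    thus ?case using Suc by (cases "i = j") auto
  qed simp
  have "inj_on (\<lambda>k. complex_of_real (- 2 * cos (\<zeta> k))) {..<n}"
  proof (rule inj_onI)
    fix i j assume ij: "i \<in> {..<n}" "j \<in> {..<n}" "complex_of_real (- 2 * cos (\<zeta> i)) = complex_of_real (- 2 * cos (\<zeta> j))"
    have "- 2 * cos (\<zeta> i) = - 2 * cos (\<zeta> j)" using ij(3) by (simp only: of_real_eq_iff)
    hence "cos (\<zeta> i) = cos (\<zeta> j)" by simp
    have ij': "i < n" "j < n" using ij(1,2) by simp_all
    have "\<zeta> i = \<zeta> j"
      by (rule cos_inj_pi[OF _ _ _ _ \<open>cos (\<zeta> i) = cos (\<zeta> j)\<close>]) (use r[OF ij'(1)] r[OF ij'(2)] in linarith)+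
    thus "i = j" using less[of i j] less[of j i] ij' by (metis less_irrefl linorder_neqE_nat)
  qed
  hence card: "card X = n" unfolding X_def by (simp add: card_image)
  have q: "map_poly complex_of_real (P n) \<noteq> 0" using nz by (simp add: map_poly_eq_0_iff)
  have "complex_of_real (- 2 * cos (\<zeta> k)) \<in> complex_zeros (P n)" if "k < n" for k
    using \<zeta>[OF that] unfolding complex_zeros_def complex_eval_def[symmetric] mem_Collect_eq complex_eval_of_real by simp
  hence "X \<subseteq> complex_zeros (P n)" unfolding X_def by blast
  moreover have fin: "finite (complex_zeros (P n))" unfolding complex_zeros_def by (rule poly_roots_finite[OF q])
  moreover have "card (complex_zeros (P n)) \<le> n"
    unfolding complex_zeros_def using card_poly_roots_bound[OF q] degree_generated[OF gen, of n]
    by (simp add: degree_map_poly)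
  ultimately have "complex_zeros (P n) = X" using card by (metis card_seteq)
  moreover have "- 2 * cos (\<zeta> k) \<in> {-2<..<2}" if "k < n" for k
    using r[OF that] cos_monotone_0_pi[of 0 "\<zeta> k"] cos_monotone_0_pi[of "\<zeta> k" pi] by auto
  ultimately show ?thesis unfolding X_def by blast
qed

text \<open>
  The zero number \<open>k\<close> has its angle between \<open>k \<pi> / (n+1)\<close> and \<open>(k+2) \<pi> / (n+1)\<close>, so any interval of
  angles of length more than \<open>3 \<pi> / (n+1)\<close> contains one of them.
\<close>

lemma zeros_dense:
  assumes gen: "generated a b P" and ab: "\<bar>b\<bar> \<le> 1 - 2 * \<bar>a\<bar>" and cd: "-2 \<le> c" "c < d" "d \<le> 2"
  shows "\<forall>\<^sub>F n in sequentially. \<exists>x\<in>{c<..<d}. complex_of_real x \<in> complex_zeros (P n)"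
proof -
  define \<alpha> \<beta> where "\<alpha> = arccos (- c / 2)" and "\<beta> = arccos (- d / 2)"
  have \<alpha>\<beta>: "0 \<le> \<alpha>" "\<alpha> < \<beta>" "\<beta> \<le> pi" "cos \<alpha> = - c / 2" "cos \<beta> = - d / 2"
    using cd by (auto simp: \<alpha>_def \<beta>_def cos_arccos arccos_less_arccos arccos_lbound arccos_ubound)
  obtain n0 :: nat where n0: "3 * pi / (\<beta> - \<alpha>) < n0" using reals_Archimedean2 by blast
  show ?thesis
  proof (rule eventually_sequentiallyI[of n0])
    fix n assume "n0 \<le> n"
    define N where "N = real n + 1"
    have N: "N > 0" by (simp add: N_def)
    have "3 * pi / (\<beta> - \<alpha>) < N" using n0 \<open>n0 \<le> n\<close> by (simp add: N_def)
    hence len: "3 * pi / N < \<beta> - \<alpha>" using N \<alpha>\<beta> by (simp add: field_simps)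
    \<comment> \<open>The first multiple of \<open>\<pi>/N\<close> not below \<open>\<alpha>\<close>; the interval up to multiple \<open>k + 2\<close> still ends before \<open>\<beta>\<close>.\<close>
    define k where "k = nat \<lceil>\<alpha> * N / pi\<rceil>"
    have "0 \<le> \<alpha> * N / pi" using \<alpha>\<beta> N by simp
    hence "\<alpha> * N / pi \<le> k" "k < \<alpha> * N / pi + 1" unfolding k_def by linarith+
    hence k: "\<alpha> \<le> real k * pi / N" "real k * pi / N < \<alpha> + pi / N" using N by (auto simp: field_simps)
    have k2: "(real k + 2) * pi / N < \<beta>"
    proof -
      have "(real k + 2) * pi / N = real k * pi / N + 2 * (pi / N)" using N by (simp add: field_simps)
      thus ?thesis using k len by simp
    qed
    hence "(real k + 2) * pi / N < pi" using \<alpha>\<beta> by linarith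
    hence "(real k + 2) * pi < N * pi" using N by (simp add: pos_divide_less_eq mult.commute)
    hence "real k + 2 < N" by simp
    hence "k < n" by (simp add: N_def)
    obtain \<theta> \<zeta> :: "nat \<Rightarrow> real"
      where \<theta>: "\<And>k. k \<le> n \<Longrightarrow> real k * pi / (real n + 1) < \<theta> k \<and> \<theta> k < (real k + 1) * pi / (real n + 1)"
        and \<zeta>: "\<And>k. k < n \<Longrightarrow> \<theta> k < \<zeta> k \<and> \<zeta> k < \<theta> (k + 1) \<and> poly (P n) (- 2 * cos (\<zeta> k)) = 0"
      using interlacing_zeros[OF gen ab] by metis
    have "\<alpha> < \<zeta> k" "\<zeta> k < \<beta>"
      using \<theta>[of k] \<theta>[of "k + 1"] \<zeta>[of k] \<open>k < n\<close> k k2 by (auto simp: N_def algebra_simps)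
    hence "cos (\<zeta> k) < cos \<alpha>" "cos \<beta> < cos (\<zeta> k)"
      using \<alpha>\<beta>(1-3) by (auto intro!: cos_monotone_0_pi)
    hence "- 2 * cos (\<zeta> k) \<in> {c<..<d}" using \<alpha>\<beta> by auto
    moreover have "complex_of_real (- 2 * cos (\<zeta> k)) \<in> complex_zeros (P n)"
      unfolding complex_zeros_def using \<zeta>[OF \<open>k < n\<close>] complex_eval_of_real[of "P n" "- 2 * cos (\<zeta> k)"] by (simp add: complex_eval_def)
    ultimately show "\<exists>x\<in>{c<..<d}. complex_of_real x \<in> complex_zeros (P n)" by blast
  qed
qed

section \<open>Nonreal zeros by a normal families argument\<close>

lemma nth_root_tendsto_growth_rate:
  fixes x y :: "nat \<Rightarrow> real"
  assumes lim: "(\<lambda>n. x n / r ^ n) \<longlonglongrightarrow> c" and "c > 0" "r > 0"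
    and y: "\<And>n. n > 0 \<Longrightarrow> y n \<ge> 0 \<and> y n ^ n = x n"
  shows "y \<longlonglongrightarrow> r"
proof -
  have "(\<lambda>n. (x n / r ^ n) powr (1 / real n)) \<longlonglongrightarrow> c powr 0"
    by (intro tendsto_powr lim lim_1_over_n) (use \<open>c > 0\<close> in simp)
  hence "(\<lambda>n. r * (x n / r ^ n) powr (1 / real n)) \<longlonglongrightarrow> r"
    using tendsto_mult_left[of _ 1 sequentially r] \<open>c > 0\<close> by simp
  moreover have "\<forall>\<^sub>F n in sequentially. r * (x n / r ^ n) powr (1 / real n) = y n"
  proof (rule eventually_sequentiallyI[of 1])
    fix n :: nat assume n: "1 \<le> n"
    have e: "x n / r ^ n = (y n / r) ^ n" using y[of n] n by (simp add: power_divide)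
    have "((y n / r) ^ n) powr (1 / real n) = root n ((y n / r) ^ n)"
      using y[of n] n \<open>r > 0\<close> by (cases "y n = 0") (auto simp: root_powr_inverse zero_power)
    also have "\<dots> = y n / r" using y[of n] n \<open>r > 0\<close> by (simp add: real_root_power_cancel)
    finally have "(x n / r ^ n) powr (1 / real n) = y n / r" unfolding e .
    thus "r * (x n / r ^ n) powr (1 / real n) = y n" using \<open>r > 0\<close> by simp
  qed
  ultimately show ?thesis by (rule Lim_transform_eventually)
qed

text \<open>
  The principle behind the Beraha-Kahane-Weiss theorem on limits of zeros: the exponential growth rate
  of a sequence of zero-free holomorphic functions is, along a subsequence, the modulus of a holomorphic
  function. If that modulus is 1 on an open set, it is 1 throughout the domain.
\<close>

lemma growth_rate_rigid:
  fixes F :: "nat \<Rightarrow> complex \<Rightarrow> complex" and B :: "complex \<Rightarrow> real"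
  assumes D: "open D" "convex D"
    and hol: "\<And>n. F n holomorphic_on D" and nz: "\<And>n v. v \<in> D \<Longrightarrow> F n v \<noteq> 0"
    and B: "continuous_on D B" "\<And>n v. v \<in> D \<Longrightarrow> cmod (F n v) \<le> B v ^ n" "\<And>v. v \<in> D \<Longrightarrow> B v \<ge> 0"
    and U: "open U" "U \<subseteq> D" "v0 \<in> U"
      "\<And>v. v \<in> U \<Longrightarrow> \<exists>c>0. (\<lambda>n. cmod (F n v)) \<longlonglongrightarrow> c"
    and v1: "v1 \<in> D" "r > 0" "c > 0" "(\<lambda>n. cmod (F n v1) / r ^ n) \<longlonglongrightarrow> c"
  shows "r = 1"
proof -
  have "\<exists>L. L holomorphic_on D \<and> (\<forall>v\<in>D. F n v = exp (L v))" for n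
    using contractible_imp_holomorphic_log[OF hol convex_imp_contractible[OF D(2)] nz] by metis
  then obtain L where L: "\<And>n. L n holomorphic_on D" "\<And>n v. v \<in> D \<Longrightarrow> F n v = exp (L n v)"
    by metis
  \<comment> \<open>A holomorphic \<open>n\<close>-th root of \<open>F n\<close>; for \<open>n = 0\<close> the division yields 0, so \<open>K 0\<close> is constantly 1.\<close>
  define K where "K n v = exp (L n v / of_nat n)" for n v
  have K_pow: "cmod (K n v) ^ n = cmod (F n v)" if "v \<in> D" "n > 0" for n v
    using that by (simp add: K_def L(2) flip: norm_power exp_of_nat_mult)
  obtain g k where g: "g holomorphic_on D" and k: "strict_mono (k :: nat \<Rightarrow> nat)"
    and lim: "\<And>v. v \<in> D \<Longrightarrow> (\<lambda>n. K (k n) v) \<longlonglongrightarrow> g v"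
  proof (rule Montel[of D "range K" K])
    show "h holomorphic_on D" if "h \<in> range K" for h
    proof -
      obtain n where "h = K n" using \<open>h \<in> range K\<close> by blast
      hence h: "h = (\<lambda>v. exp (L n v / of_nat n))" by (simp add: K_def fun_eq_iff)
      show ?thesis
        by (cases "n = 0") (use L(1) in \<open>auto simp: h intro!: holomorphic_intros\<close>)
    qed
    show "\<exists>M. \<forall>h\<in>range K. \<forall>z\<in>S. cmod (h z) \<le> M" if S: "compact S" "S \<subseteq> D" for S
    proof -
      have "bounded (B ` S)"
        using S B(1) by (meson compact_continuous_image compact_imp_bounded continuous_on_subset)
      then obtain M where M: "\<And>z. z \<in> S \<Longrightarrow> \<bar>B z\<bar> \<le> M" by (auto simp: bounded_iff)
      have "cmod (K n z) \<le> max 1 M" if z: "z \<in> S" for n z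
      proof (cases "n = 0")
        case False
        have "cmod (K n z) ^ n \<le> B z ^ n" using K_pow[of z n] B(2)[of z n] z S False by auto
        hence "cmod (K n z) \<le> B z" using False B(3)[of z] z S by (simp add: power_mono_iff subset_eq)
        thus ?thesis using M[OF z] by simp
      qed (simp add: K_def)
      thus ?thesis by (intro exI[of _ "max 1 M"]) auto
    qed
  qed (use D(1) in auto)
  have rate: "cmod (g v) = \<rho>"
    if v: "v \<in> D" "\<rho> > 0" "d > 0" "(\<lambda>n. cmod (F n v) / \<rho> ^ n) \<longlonglongrightarrow> d" for v \<rho> d
  proof -
    have "(\<lambda>n. cmod (K n v)) \<longlonglongrightarrow> \<rho>"
      by (rule nth_root_tendsto_growth_rate[OF v(4,3,2)]) (use K_pow v(1) in auto)
    hence "(\<lambda>n. cmod (K (k n) v)) \<longlonglongrightarrow> \<rho>"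
      using LIMSEQ_subseq_LIMSEQ[OF _ k] by (auto simp: o_def)
    thus ?thesis using tendsto_norm[OF lim[OF v(1)]] LIMSEQ_unique by blast
  qed
  have g1: "cmod (g v) = 1" if v: "v \<in> U" for v
  proof -
    obtain d where "d > 0" "(\<lambda>n. cmod (F n v)) \<longlonglongrightarrow> d" using U(4) v by blast
    thus ?thesis using rate[of v 1 d] v U(2) by auto
  qed
  have "g constant_on D"
    using maximum_modulus_principle[OF g D(1) convex_connected[OF D(2)] U(1,2,3)] g1 U(3) by simp
  hence "g v1 = g v0" using v1(1) U(2,3) unfolding constant_on_def by (metis subsetD)
  thus "r = 1" using rate[OF v1] g1[OF U(3)] by simp
qed

lemma dominant_power_tendsto:
  fixes p q s :: complex
  assumes "cmod q < cmod p" "cmod s < cmod p"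
  shows "(\<lambda>n. cmod (A * p ^ n + B * q ^ n + C * s ^ n) / cmod p ^ n) \<longlonglongrightarrow> cmod A"
proof -
  have p: "p \<noteq> 0" using assms(1) by auto
  have z: "(\<lambda>n. (x / p) ^ n) \<longlonglongrightarrow> 0" if "cmod x < cmod p" for x
    by (rule LIMSEQ_power_zero) (use that p in \<open>simp add: norm_divide\<close>)
  have "(\<lambda>n. cmod (A + B * (q / p) ^ n + C * (s / p) ^ n)) \<longlonglongrightarrow> cmod (A + B * 0 + C * 0)"
    by (intro tendsto_intros z assms)
  moreover have "A + B * (q / p) ^ n + C * (s / p) ^ n = (A * p ^ n + B * q ^ n + C * s ^ n) / p ^ n" for n
    using p by (simp add: field_simps)
  ultimately show ?thesis by (simp add: norm_divide norm_power)
qed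

text \<open>
  The map \<open>v \<mapsto> - (e\<^sup>v + e\<^bsup>-v\<^esup>)\<close> takes this set into the nonreal numbers. Using \<open>v\<close> rather than
  \<open>u = e\<^sup>v\<close> as the variable makes the domain convex, so that holomorphic logarithms exist on it.
\<close>

definition half_strip :: "complex set" where
  "half_strip = {v. 0 < Re v \<and> 0 < Im v \<and> Im v < pi}"

lemma open_half_strip: "open half_strip"
  unfolding half_strip_def
  by (intro open_Collect_conj open_Collect_less continuous_intros)

lemma convex_half_strip: "convex half_strip"
proof -
  have e: "half_strip = {v. Re v > 0} \<inter> {v. Im v > 0} \<inter> {v. Im v < pi}"
    by (auto simp: half_strip_def)
  show ?thesis
    unfolding e by (auto intro!: convex_Int convex_halfspace_Re_gt convex_halfspace_Im_gt convex_halfspace_Im_lt)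
qed

text \<open>
  Strict inequalities between moduli that hold at a boundary point of the half strip also hold somewhere
  inside it. At boundary points \<open>e\<^sup>v + e\<^bsup>-v\<^esup>\<close> is real, which makes suitable points easy to name.
\<close>

lemma open_meets_half_strip:
  assumes "open G" "v \<in> G" "0 \<le> Re v" "0 \<le> Im v" "Im v \<le> pi"
  shows "\<exists>v'\<in>half_strip. v' \<in> G"
proof -
  define S where "S = box 0 (Complex (Re v + 1) pi)"
  have "Complex 1 1 / 2 \<in> box 0 (Complex (Re v + 1) pi) "
    using assms pi_gt3 by (auto simp: in_box_complex_iff)
  hence "closure S = cbox 0 (Complex (Re v + 1) pi)"
    unfolding S_def by (intro closure_box) auto
  hence "v \<in> closure S" using assms by (simp add: in_cbox_complex_iff)
  hence "G \<inter> S \<noteq> {}" using assms(1,2) open_Int_closure_eq_empty[of G S] by blast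
  moreover have "S \<subseteq> half_strip" by (auto simp: S_def half_strip_def in_box_complex_iff)
  ultimately show ?thesis by blast
qed

lemma joukowski_not_real:
  assumes "v \<in> half_strip"
  shows "- (exp v + exp (- v)) \<notin> \<real>"
proof -
  have "Im (exp v + exp (- v)) = (exp (Re v) - exp (- Re v)) * sin (Im v)"
    by (simp add: Im_exp algebra_simps)
  moreover have "sin (Im v) > 0" "exp (- Re v) < exp (Re v)"
    using assms by (auto simp: half_strip_def intro: sin_gt_zero)
  ultimately have "Im (exp v + exp (- v)) \<noteq> 0" by simp
  thus ?thesis by (auto simp: complex_is_Real_iff)
qed

lemma joukowski_surj:
  fixes t :: real
  shows "\<exists>v. 0 \<le> Re v \<and> 0 \<le> Im v \<and> Im v \<le> pi \<and> exp v + exp (- v) = complex_of_real t"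
proof -
  consider "\<bar>t\<bar> \<le> 2" | "t > 2" | "t < -2" by linarith
  thus ?thesis
  proof cases
    case 1
    have "exp (\<i> * of_real (arccos (t / 2))) + exp (- (\<i> * of_real (arccos (t / 2)))) = 2 * cos (of_real (arccos (t / 2)))"
      by (simp add: cos_exp_eq)
    also have "\<dots> = complex_of_real t" using 1 by (simp add: cos_of_real)
    finally show ?thesis
      using 1 arccos_bounded[of "t / 2"] by (intro exI[of _ "\<i> * of_real (arccos (t / 2))"]) auto
  next
    case 2
    have "exp (arcosh (t / 2)) + exp (- arcosh (t / 2)) = t"
      using cosh_arcosh_real[of "t / 2"] 2 by (simp add: cosh_field_def)
    hence "exp (of_real (arcosh (t / 2))) + exp (- of_real (arcosh (t / 2))) = complex_of_real t"
      by (metis exp_of_real of_real_add of_real_minus)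
    thus ?thesis using 2 by (intro exI[of _ "of_real (arcosh (t / 2))"]) auto
  next
    case 3
    let ?x = "arcosh (- t / 2)"
    have "exp ?x + exp (- ?x) = - t"
      using cosh_arcosh_real[of "- t / 2"] 3 by (simp add: cosh_field_def)
    hence "exp (of_real ?x) + exp (- of_real ?x) = - complex_of_real t"
      by (metis exp_of_real of_real_add of_real_minus)
    note h = this
    have e: "exp (of_real ?x + \<i> * pi) = - exp (of_real ?x)"
      "exp (- (of_real ?x + \<i> * pi)) = - exp (- of_real ?x)"
      by (simp_all add: exp_add exp_diff exp_minus)
    have "exp (of_real ?x + \<i> * pi) + exp (- (of_real ?x + \<i> * pi)) = - (exp (of_real ?x) + exp (- of_real ?x))"
      unfolding e by simp
    also have "\<dots> = complex_of_real t" unfolding h by simp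
    finally have "exp (of_real ?x + \<i> * pi) + exp (- (of_real ?x + \<i> * pi)) = complex_of_real t" .
    moreover have "0 \<le> ?x" using 3 by simp
    ultimately show ?thesis using pi_ge_zero by (intro exI[of _ "of_real ?x + \<i> * pi"]) (auto simp del: pi_ge_zero)
  qed
qed

text \<open>
  On \<open>G1\<close> the power of \<open>w\<close> dominates and on \<open>G2\<close> that of \<open>u = e\<^sup>v\<close>. The condition
  \<open>w \<noteq> e\<^bsup>-v\<^esup>\<close> in \<open>G2\<close> ensures that the coefficient of \<open>u\<^sup>n\<close> and the Vandermonde factor
  \<open>\<delta>\<close> do not vanish.
\<close>

lemma nonreal_zero_exists:
  assumes gen: "generated a b P" and ab: "1 - 2 * \<bar>a\<bar> < \<bar>b\<bar>"
  shows "\<exists>n. \<not> complex_zeros (P n) \<subseteq> \<real>"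
proof (rule ccontr)
  assume neg: "\<not> ?thesis"
  define z where "z v = - (exp v + exp (- v))" for v :: complex
  define w where "w v = - (of_real a * z v + of_real b)" for v
  define F where "F n v = complex_eval (P n) (z v) * exp (- v) ^ n" for n v
  define \<delta> where "\<delta> v = (w v - exp v) * (w v - exp (- v)) * (exp v - exp (- v))" for v
  have [continuous_intros]: "continuous_on S z" "continuous_on S w" for S
    unfolding z_def w_def by (auto intro!: continuous_intros)
  have uv: "cmod (exp (- v)) < 1" "1 < cmod (exp v)" "exp v \<noteq> exp (- v)" if "v \<in> half_strip" for v
  proof -
    show 1: "cmod (exp (- v)) < 1" "1 < cmod (exp v)" using that by (auto simp: half_strip_def)
    show "exp v \<noteq> exp (- v)" using 1 by (metis less_asym)
  qed
  have cf: "\<delta> v * complex_eval (P n) (z v) = w v ^ (n + 2) * (exp v - exp (- v))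
      - exp v ^ (n + 2) * (w v - exp (- v)) + exp (- v) ^ (n + 2) * (w v - exp v)" for n v
    unfolding \<delta>_def by (rule generated_closed_form[OF gen]) (simp_all add: z_def w_def exp_minus)
  have F_scaled: "cmod (F n v) / (R / cmod (exp v)) ^ n = cmod (complex_eval (P n) (z v)) / R ^ n" for n v R
    by (simp add: F_def norm_mult norm_power exp_minus norm_inverse norm_divide power_divide field_simps)
  define G1 where "G1 = {v. cmod (exp v) < cmod (w v)}"
  define G2 where "G2 = {v. cmod (w v) < cmod (exp v)} \<inter> {v. w v \<noteq> exp (- v)}"
  have "open G1" unfolding G1_def by (intro open_Collect_less continuous_intros)
  have "open G2" unfolding G2_def by (intro open_Int open_Collect_less open_Collect_neq continuous_intros)

  \<comment> \<open>At the corners \<open>v = 0\<close> and \<open>v = i \<pi>\<close> of the half strip, \<open>\<bar>u\<bar> = 1\<close> and \<open>\<bar>w\<bar> = \<bar>\<plusminus>2 a - b\<bar>\<close>.\<close>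
  have "\<exists>v\<in>half_strip. v \<in> G1"
  proof -
    have "1 < \<bar>2 * a - b\<bar> \<or> 1 < \<bar>- 2 * a - b\<bar>" using ab by linarith
    moreover have "w 0 = of_real (2 * a - b)" "w (\<i> * pi) = of_real (- 2 * a - b)"
      by (simp_all add: w_def z_def exp_minus algebra_simps)
    ultimately have "cmod (w 0) > 1 \<or> cmod (w (\<i> * pi)) > 1" by (metis norm_of_real)
    hence "0 \<in> G1 \<or> \<i> * pi \<in> G1" by (simp add: G1_def)
    thus ?thesis using open_meets_half_strip[OF \<open>open G1\<close>, of 0] open_meets_half_strip[OF \<open>open G1\<close>, of "\<i> * pi"] by auto
  qed
  then obtain v1 where v1: "v1 \<in> half_strip" "v1 \<in> G1" by blast

  \<comment> \<open>For \<open>a \<noteq> 0\<close> the real zero \<open>-b/a\<close> of \<open>w\<close> serves; for \<open>a = 0\<close> any large real \<open>v\<close> does.\<close>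
  have "\<exists>v\<in>G2. 0 \<le> Re v \<and> 0 \<le> Im v \<and> Im v \<le> pi"
  proof (cases "a = 0")
    case True
    have b: "\<bar>b\<bar> > 1" using ab True by simp
    have "\<bar>b\<bar> < exp \<bar>b\<bar>" using exp_ge_add_one_self[of "\<bar>b\<bar>"] by linarith
    moreover have "w (of_real \<bar>b\<bar>) = - of_real b" by (simp add: w_def True)
    moreover have "cmod (exp (- of_real \<bar>b\<bar>)) < 1" using b by simp
    hence "- of_real b \<noteq> exp (- complex_of_real \<bar>b\<bar>)" using b by (metis norm_minus_cancel norm_of_real order_less_asym)
    ultimately have "of_real \<bar>b\<bar> \<in> G2" by (auto simp: G2_def)
    thus ?thesis by (intro bexI[of _ "of_real \<bar>b\<bar>"]) auto
  next
    case False
    obtain v where v: "0 \<le> Re v" "0 \<le> Im v" "Im v \<le> pi" "exp v + exp (- v) = complex_of_real (b / a)"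
      using joukowski_surj by blast
    have "w v = 0" unfolding w_def z_def v(4) using False by simp
    thus ?thesis using v(1-3) by (intro bexI[of _ v]) (auto simp: G2_def)
  qed
  then obtain v0 where v0: "v0 \<in> half_strip" "v0 \<in> G2"
    using open_meets_half_strip[OF \<open>open G2\<close>] by blast

  have rate1: "\<exists>c>0. (\<lambda>n. cmod (F n v)) \<longlonglongrightarrow> c" if v: "v \<in> G2 \<inter> half_strip" for v
  proof -
    define A where "A = - (exp v ^ 2 * (w v - exp (- v)))"
    have d: "\<delta> v \<noteq> 0" using v uv[of v] by (auto simp: \<delta>_def G2_def)
    have "(\<lambda>n. cmod (A * exp v ^ n + (w v ^ 2 * (exp v - exp (- v))) * w v ^ n
        + (exp (- v) ^ 2 * (w v - exp v)) * exp (- v) ^ n) / cmod (exp v) ^ n) \<longlonglongrightarrow> cmod A"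
      by (rule dominant_power_tendsto) (use v uv[of v] in \<open>auto simp: G2_def\<close>)
    also have "(\<lambda>n. A * exp v ^ n + (w v ^ 2 * (exp v - exp (- v))) * w v ^ n
        + (exp (- v) ^ 2 * (w v - exp v)) * exp (- v) ^ n) = (\<lambda>n. \<delta> v * complex_eval (P n) (z v))"
      unfolding cf A_def by (simp add: power_add power2_eq_square algebra_simps)
    finally have "(\<lambda>n. cmod (complex_eval (P n) (z v)) / cmod (exp v) ^ n) \<longlonglongrightarrow> cmod A / cmod (\<delta> v)"
      using d tendsto_divide[OF _ tendsto_const[of "cmod (\<delta> v)"]] by (fastforce simp: norm_mult)
    moreover have "cmod A / cmod (\<delta> v) > 0" using d v by (auto simp: A_def G2_def)
    ultimately show ?thesis using F_scaled[of _ v "cmod (exp v)"] by (auto simp del: norm_exp_eq_Re)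
  qed

  have "\<exists>c>0. (\<lambda>n. cmod (F n v1) / (cmod (w v1) / cmod (exp v1)) ^ n) \<longlonglongrightarrow> c"
  proof -
    define A where "A = w v1 ^ 2 * (exp v1 - exp (- v1))"
    have w1: "cmod (exp v1) < cmod (w v1)" using v1 by (simp add: G1_def)
    have w0: "w v1 \<noteq> 0" using w1 by (intro notI) simp
    have w1': "cmod (exp (- v1)) < cmod (w v1)" using w1 uv(1,2)[OF v1(1)] by linarith
    have d: "\<delta> v1 \<noteq> 0" using w1 uv[OF v1(1)] by (auto simp: \<delta>_def)
    have "(\<lambda>n. cmod (A * w v1 ^ n + (- (exp v1 ^ 2 * (w v1 - exp (- v1)))) * exp v1 ^ n
        + (exp (- v1) ^ 2 * (w v1 - exp v1)) * exp (- v1) ^ n) / cmod (w v1) ^ n) \<longlonglongrightarrow> cmod A"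
      by (rule dominant_power_tendsto) (fact w1 w1')+
    also have "(\<lambda>n. A * w v1 ^ n + (- (exp v1 ^ 2 * (w v1 - exp (- v1)))) * exp v1 ^ n
        + (exp (- v1) ^ 2 * (w v1 - exp v1)) * exp (- v1) ^ n) = (\<lambda>n. \<delta> v1 * complex_eval (P n) (z v1))"
      unfolding cf A_def by (simp add: power_add power2_eq_square algebra_simps)
    finally have "(\<lambda>n. cmod (complex_eval (P n) (z v1)) / cmod (w v1) ^ n) \<longlonglongrightarrow> cmod A / cmod (\<delta> v1)"
      using d tendsto_divide[OF _ tendsto_const[of "cmod (\<delta> v1)"]] by (fastforce simp: norm_mult)
    moreover have "cmod A / cmod (\<delta> v1) > 0" using d w0 uv(3)[OF v1(1)] by (simp add: A_def norm_mult)
    ultimately show ?thesis unfolding F_scaled by blast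
  qed
  then obtain c where c: "c > 0"
    "(\<lambda>n. cmod (F n v1) / (cmod (w v1) / cmod (exp v1)) ^ n) \<longlonglongrightarrow> c" by blast

  \<comment> \<open>The factor \<open>\<bar>e\<^bsup>-v\<^esup>\<bar>\<close> is the \<open>n\<close>-th root of the modulus of the normalising factor in \<open>F n\<close>.\<close>
  define B where "B v = (1 + cmod (complex_eval (denom_coeff1 a b) (z v)) + cmod (complex_eval (denom_coeff2 a b) (z v))
    + cmod (complex_eval (denom_coeff3 a b) (z v))) * cmod (exp (- v))" for v
  have "cmod (w v1) / cmod (exp v1) = 1"
  proof (rule growth_rate_rigid[of half_strip F B "G2 \<inter> half_strip" v0 v1 _ c])
    show "F n holomorphic_on half_strip" for n
      unfolding F_def z_def by (intro holomorphic_intros)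
    show "F n v \<noteq> 0" if "v \<in> half_strip" for n v
    proof -
      have "z v \<notin> \<real>" using joukowski_not_real[OF that] by (simp add: z_def)
      hence "z v \<notin> complex_zeros (P n)" using neg by blast
      thus ?thesis by (simp add: F_def complex_zeros_def complex_eval_def)
    qed
    show "continuous_on half_strip B" unfolding B_def by (intro continuous_intros)
    show "cmod (F n v) \<le> B v ^ n" for n v
      unfolding F_def B_def power_mult_distrib norm_mult norm_power
      by (intro mult_right_mono generated_exponential_bound[OF gen]) simp
    show "B v \<ge> 0" for v by (simp add: B_def)
    show "0 < cmod (w v1) / cmod (exp v1)"
      using v1 uv(2)[OF v1(1)] unfolding G1_def by (metis divide_pos_pos mem_Collect_eq norm_ge_zero order_le_less_trans zero_less_norm_iff exp_not_eq_zero)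
  qed (use open_half_strip convex_half_strip \<open>open G2\<close> v0 v1 c rate1 in auto)
  thus False using v1 by (auto simp: G1_def divide_simps split: if_splits)
qed
theorem theorem8:
  fixes a b :: real and P :: "nat \<Rightarrow> real poly"
  assumes "generated a b P"
  shows "((\<forall>n. complex_zeros (P n) \<subseteq> \<real>) \<longleftrightarrow> \<bar>b\<bar> \<le> 1 - 2 * \<bar>a\<bar>) \<and>
    (\<bar>b\<bar> \<le> 1 - 2 * \<bar>a\<bar> \<longrightarrow>
      (\<forall>n. complex_zeros (P n) \<subseteq> complex_of_real ` {-2<..<2}) \<and>
      (\<forall>c d :: real. -2 \<le> c \<and> c < d \<and> d \<le> 2 \<longrightarrow>
        (\<forall>\<^sub>F n in sequentially. \<exists>x\<in>{c<..<d}. complex_of_real x \<in> complex_zeros (P n))))"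
proof (intro conjI impI allI)
  show "(\<forall>n. complex_zeros (P n) \<subseteq> \<real>) \<longleftrightarrow> \<bar>b\<bar> \<le> 1 - 2 * \<bar>a\<bar>"
  proof
    assume "\<forall>n. complex_zeros (P n) \<subseteq> \<real>"
    thus "\<bar>b\<bar> \<le> 1 - 2 * \<bar>a\<bar>"
      using nonreal_zero_exists[OF assms] by (meson not_le)
  next
    assume "\<bar>b\<bar> \<le> 1 - 2 * \<bar>a\<bar>"
    thus "\<forall>n. complex_zeros (P n) \<subseteq> \<real>"
      using zeros_in_interval[OF assms] by fastforce
  qed
qed (use zeros_in_interval[OF assms] zeros_dense[OF assms] in auto)

end
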